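(* For each of the $14400$ pairs $(a,b)\in S_{H_4}\times S_{H_4}$, the element $$x=\frac{a+b\ell}{2}\in\mathbb{O}(K)$$ has norm $N(x)=\tfrac12$. Hence none of these elements has norm in $\mathbb{Z}[\varphi]$, i.e. none is an integral-norm element for the strict $\mathbb{Z}[\varphi]$-order convention.
   Context: Let $\varphi=(1+\sqrt5)/2$, $K=\mathbb{Q}(\sqrt5)$. $\mathbb{H}(K)$ is the quaternion algebra over $K$ with basis $1,i,j,k$, $i^2=j^2=k^2=ijk=-1$, standard conjugation. $S_{H_4}\subset\mathbb{H}(K)$ is the set of $120$ quaternions $a+bi+cj+dk$ whose coordinate vector $(a,b,c,d)$ is one of: all permutations of $(\pm1,0,0,0)$; $\frac12(\pm1,\pm1,\pm1,\pm1)$ with all signs; all even permutations of $\frac12(0,\pm1,\pm\varphi,\pm\varphi^{-1})$ with all signs. $\mathbb{O}(K)=\mathbb{H}(K)\oplus\mathbb{H}(K)\ell$ is the Cayley--Dickson double with product $(a+b\ell)(c+d\ell)=(ac-\overline{d}b)+(da+b\overline{c})\ell$, conjugation $\overline{a+b\ell}=\overline{a}-b\ell$, and norm $N(x)=x\overline{x}$. The strict $\mathbb{Z}[\varphi]$-order convention requires every element of an order to have norm in $\mathbb{Z}[\varphi]$. *)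

theory Defs
  imports Complex_Main "HOL-Combinatorics.Permutations" "HOL-Computational_Algebra.Polynomial"
begin

section \<open>The field \<open>K = \<rat>(\<surd>5)\<close>\<close>

typedef qsqrt5 = "{x::real. \<exists>a b::rat. x = of_rat a + of_rat b * sqrt 5}"
  morphisms real_of_qsqrt5 Abs_qsqrt5
  by (rule exI[of _ 0], auto intro!: exI[of _ 0])

setup_lifting type_definition_qsqrt5

lemma sqrt5_irrat: "sqrt 5 \<noteq> of_rat r"
proof
  assume "sqrt 5 = real_of_rat r"
  then have "real_of_rat (r^2) = real_of_rat 5"
    by (metis of_rat_power of_rat_numeral_eq real_sqrt_pow2 zero_le_numeral)
  then have r: "r^2 = 5" by (simp only: of_rat_eq_iff)
  obtain p q where pq: "quotient_of r = (p, q)" by fastforce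
  then have q: "q > 0" and cop: "coprime p q" and rr: "r = of_int p / of_int q"
    by (auto simp: quotient_of_denom_pos quotient_of_coprime quotient_of_div)
  have "rat_of_int (p^2) = of_int (5 * q^2)"
    using r q rr by (simp add: field_simps power2_eq_square)
  then have eq: "p^2 = 5 * q^2" by (simp only: of_int_eq_iff)
  have p5: "prime (5::int)"
    by (simp add: prime_int_numeral_eq)
  have "5 dvd p^2" using eq by simp
  then have d: "5 dvd p" using p5 prime_dvd_power by blast
  then obtain m where m: "p = 5 * m" by auto
  have "q^2 = 5 * m^2" using eq m by (simp add: power2_eq_square)
  then have "5 dvd q^2" by simp
  then have "5 dvd q" using p5 prime_dvd_power by blast
  with cop d have "is_unit (5::int)" by (rule coprime_common_divisor)
  then show False by simp
qed

lemma qsqrt5_inverse_closed: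
  "\<exists>c d. inverse (of_rat a + of_rat b * sqrt 5) = of_rat c + of_rat d * sqrt 5"
proof (cases "a = 0 \<and> b = 0")
  case True
  then show ?thesis by (intro exI[of _ 0]) simp
next
  case False
  let ?n = "a^2 - 5 * b^2"
  have n: "real_of_rat ?n = (of_rat a + of_rat b * sqrt 5) * (of_rat a - of_rat b * sqrt 5)"
    by (simp add: of_rat_diff of_rat_mult of_rat_power power2_eq_square algebra_simps)
  have nz: "of_rat a + of_rat b' * sqrt 5 \<noteq> 0" if "b' = b \<or> b' = - b" for b'
  proof
    assume e: "of_rat a + of_rat b' * sqrt 5 = 0"
    show False
    proof (cases "b' = 0")
      case True
      then show False using e that False by auto
    next
      case b': False
      then have "sqrt 5 = of_rat (- a / b')"
        using e by (simp add: of_rat_divide of_rat_minus field_simps)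
      then show False using sqrt5_irrat by blast
    qed
  qed
  have "of_rat a - of_rat b * sqrt 5 \<noteq> 0"
    using nz[of "-b"] by (simp add: of_rat_minus)
  then have "inverse (of_rat a + of_rat b * sqrt 5) = (of_rat a - of_rat b * sqrt 5) / of_rat ?n"
    unfolding n using nz[of b] by (simp add: divide_inverse)
  also have "\<dots> = of_rat (a / ?n) + of_rat (- b / ?n) * sqrt 5"
    by (simp only: of_rat_divide of_rat_minus) (simp add: diff_divide_distrib)
  finally show ?thesis by blast
qed

lemma qsqrt5_mult_closed:
  "\<exists>e f. (of_rat a + of_rat b * sqrt 5) * (of_rat c + of_rat d * sqrt 5) = of_rat e + of_rat f * sqrt 5"
  by (rule exI[of _ "a * c + 5 * b * d"], rule exI[of _ "a * d + b * c"])
     (simp add: of_rat_add of_rat_mult algebra_simps)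

instantiation qsqrt5 :: field
begin

lift_definition zero_qsqrt5 :: qsqrt5 is 0
  by (intro exI[of _ 0]) simp

lift_definition one_qsqrt5 :: qsqrt5 is 1
  by (rule exI[of _ 1], rule exI[of _ 0]) simp

lift_definition plus_qsqrt5 :: "qsqrt5 \<Rightarrow> qsqrt5 \<Rightarrow> qsqrt5" is "(+)"
proof clarify
  fix a b c d :: rat
  show "\<exists>e f. real_of_rat a + of_rat b * sqrt 5 + (of_rat c + of_rat d * sqrt 5) = of_rat e + of_rat f * sqrt 5"
    by (rule exI[of _ "a + c"], rule exI[of _ "b + d"]) (simp add: of_rat_add algebra_simps)
qed

lift_definition minus_qsqrt5 :: "qsqrt5 \<Rightarrow> qsqrt5 \<Rightarrow> qsqrt5" is "(-)"
proof clarify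
  fix a b c d :: rat
  show "\<exists>e f. real_of_rat a + of_rat b * sqrt 5 - (of_rat c + of_rat d * sqrt 5) = of_rat e + of_rat f * sqrt 5"
    by (rule exI[of _ "a - c"], rule exI[of _ "b - d"]) (simp add: of_rat_diff algebra_simps)
qed

lift_definition uminus_qsqrt5 :: "qsqrt5 \<Rightarrow> qsqrt5" is uminus
proof clarify
  fix a b :: rat
  show "\<exists>e f. - (real_of_rat a + of_rat b * sqrt 5) = of_rat e + of_rat f * sqrt 5"
    by (rule exI[of _ "- a"], rule exI[of _ "- b"]) (simp add: of_rat_minus)
qed

lift_definition times_qsqrt5 :: "qsqrt5 \<Rightarrow> qsqrt5 \<Rightarrow> qsqrt5" is "(*)"
  using qsqrt5_mult_closed by blast

lift_definition inverse_qsqrt5 :: "qsqrt5 \<Rightarrow> qsqrt5" is inverse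
  using qsqrt5_inverse_closed by blast

definition divide_qsqrt5 :: "qsqrt5 \<Rightarrow> qsqrt5 \<Rightarrow> qsqrt5"
  where "divide_qsqrt5 x y = x * inverse y"

instance
  by standard (simp add: divide_qsqrt5_def | transfer, simp add: algebra_simps)+

end

lemma real_of_qsqrt5_of_nat: "real_of_qsqrt5 (of_nat n) = of_nat n"
  by (induction n) (simp_all add: zero_qsqrt5.rep_eq one_qsqrt5.rep_eq plus_qsqrt5.rep_eq)

instance qsqrt5 :: field_char_0
proof
  show "inj (of_nat :: nat \<Rightarrow> qsqrt5)"
    by (rule injI) (metis real_of_qsqrt5_of_nat of_nat_eq_iff)
qed

lift_definition sqrt5 :: qsqrt5 is "sqrt 5"
  by (rule exI[of _ 0], rule exI[of _ 1]) simp

lemma sqrt5_square: "sqrt5 * sqrt5 = 5"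
proof -
  have "real_of_qsqrt5 5 = 5" using real_of_qsqrt5_of_nat[of 5] by simp
  then show ?thesis
    by (simp add: real_of_qsqrt5_inject[symmetric] times_qsqrt5.rep_eq sqrt5.rep_eq)
qed

definition phi :: qsqrt5 ("\<phi>")
  where "\<phi> = (1 + sqrt5) / 2"

lemma phi_square: "\<phi> * \<phi> = \<phi> + 1"
  by (simp add: phi_def field_simps sqrt5_square)

definition Z_phi :: "qsqrt5 set" ("\<int>[\<phi>]")
  where "\<int>[\<phi>] = {poly (map_poly of_int p) \<phi> | p :: int poly. True}"


section \<open>Quaternions\<close>

datatype 'a quat = Quat (qRe: 'a) (qI: 'a) (qJ: 'a) (qK: 'a)

lemma quat_eqI: "qRe x = qRe y \<Longrightarrow> qI x = qI y \<Longrightarrow> qJ x = qJ y \<Longrightarrow> qK x = qK y \<Longrightarrow> x = y"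
  by (rule quat.expand) simp

instantiation quat :: (comm_ring_1) ring_1
begin

definition "0 = Quat 0 0 0 0"
definition "1 = Quat 1 0 0 0"
definition "x + y = Quat (qRe x + qRe y) (qI x + qI y) (qJ x + qJ y) (qK x + qK y)"
definition "x - y = Quat (qRe x - qRe y) (qI x - qI y) (qJ x - qJ y) (qK x - qK y)"
definition "- x = Quat (- qRe x) (- qI x) (- qJ x) (- qK x)"
definition "x * y = Quat
  (qRe x * qRe y - qI x * qI y - qJ x * qJ y - qK x * qK y)
  (qRe x * qI y + qI x * qRe y + qJ x * qK y - qK x * qJ y)
  (qRe x * qJ y - qI x * qK y + qJ x * qRe y + qK x * qI y)
  (qRe x * qK y + qI x * qJ y - qJ x * qI y + qK x * qRe y)"

instance
  by standard
    (simp_all add: zero_quat_def one_quat_def plus_quat_def minus_quat_def uminus_quat_def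
      times_quat_def algebra_simps)

end

definition quat_i :: "'a::comm_ring_1 quat" where "quat_i = Quat 0 1 0 0"
definition quat_j :: "'a::comm_ring_1 quat" where "quat_j = Quat 0 0 1 0"
definition quat_k :: "'a::comm_ring_1 quat" where "quat_k = Quat 0 0 0 1"

lemma quat_relations:
  "quat_i * quat_i = (- 1 :: 'a::comm_ring_1 quat)"
  "quat_j * quat_j = (- 1 :: 'a quat)"
  "quat_k * quat_k = (- 1 :: 'a quat)"
  "quat_i * quat_j * quat_k = (- 1 :: 'a quat)"
  by (simp_all add: quat_i_def quat_j_def quat_k_def times_quat_def one_quat_def uminus_quat_def)

definition qconj :: "'a::comm_ring_1 quat \<Rightarrow> 'a quat"
  where "qconj x = Quat (qRe x) (- qI x) (- qJ x) (- qK x)"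

definition qscale :: "'a::comm_ring_1 \<Rightarrow> 'a quat \<Rightarrow> 'a quat"
  where "qscale r x = Quat (r * qRe x) (r * qI x) (r * qJ x) (r * qK x)"

definition coords :: "'a quat \<Rightarrow> 'a list"
  where "coords x = [qRe x, qI x, qJ x, qK x]"

definition S_H4 :: "qsqrt5 quat set" where
  "S_H4 = {x. coords x \<in>
      {permute_list \<pi> [s, 0, 0, 0] | \<pi> s. \<pi> permutes {..<4} \<and> s \<in> {1, - 1}}
    \<union> {map (\<lambda>s. 1/2 * s) [s0, s1, s2, s3] | s0 s1 s2 s3. {s0, s1, s2, s3} \<subseteq> {1, - 1}}
    \<union> {permute_list \<pi> (map (\<lambda>c. 1/2 * c) [0, s1 * 1, s2 * \<phi>, s3 * inverse \<phi>]) | \<pi> s1 s2 s3.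
          \<pi> permutes {..<4} \<and> evenperm \<pi> \<and> {s1, s2, s3} \<subseteq> {1, - 1}}}"


section \<open>The Cayley--Dickson double\<close>

text \<open>\<open>Octo a b\<close> stands for \<open>a + b\<ell>\<close>; see \<open>Octo_eq\<close> below.\<close>

datatype 'a octo = Octo (oFst: "'a quat") (oSnd: "'a quat")

instantiation octo :: (comm_ring_1) "{zero, one, plus, minus, uminus, times}"
begin

definition "0 = Octo 0 0"
definition "1 = Octo 1 0"
definition "x + y = Octo (oFst x + oFst y) (oSnd x + oSnd y)"
definition "x - y = Octo (oFst x - oFst y) (oSnd x - oSnd y)"
definition "- x = Octo (- oFst x) (- oSnd x)"
definition "x * y = (case (x, y) of (Octo a b, Octo c d) \<Rightarrow>
  Octo (a * c - qconj d * b) (d * a + b * qconj c))"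

instance ..

end

definition octo_l :: "'a::comm_ring_1 octo" where "octo_l = Octo 0 1"

lemma Octo_eq: "Octo a b = Octo a 0 + Octo b 0 * octo_l"
  by (simp add: octo_l_def plus_octo_def times_octo_def)

definition oconj :: "'a::comm_ring_1 octo \<Rightarrow> 'a octo"
  where "oconj x = Octo (qconj (oFst x)) (- oSnd x)"

definition oscale :: "'a::comm_ring_1 \<Rightarrow> 'a octo \<Rightarrow> 'a octo"
  where "oscale r x = Octo (qscale r (oFst x)) (qscale r (oSnd x))"

definition octo_of :: "'a::comm_ring_1 \<Rightarrow> 'a octo"
  where "octo_of r = oscale r 1"

lemma octo_of_mult: "octo_of r * x = oscale r x"
  by (cases x) (simp add: octo_of_def oscale_def times_octo_def one_octo_def zero_quat_def
      one_quat_def qscale_def times_quat_def qconj_def minus_quat_def plus_quat_def algebra_simps)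

lemma inj_octo_of: "inj octo_of"
  by (rule injI) (simp add: octo_of_def oscale_def one_octo_def one_quat_def qscale_def)

text \<open>The norm is the product \<open>x * oconj x\<close> itself, an element of the octonion algebra; the scalars
  \<open>r \<in> K\<close> sit inside that algebra as \<open>octo_of r\<close>.\<close>

definition octo_norm :: "'a::comm_ring_1 octo \<Rightarrow> 'a octo"
  where "octo_norm x = x * oconj x"

text \<open>The strict order convention for \<open>\<int>[\<phi>]\<close>-orders in \<open>O(K)\<close> requires this of every element of
  an order.\<close>

definition integral_norm :: "qsqrt5 octo \<Rightarrow> bool"
  where "integral_norm x \<longleftrightarrow> octo_norm x \<in> octo_of ` \<int>[\<phi>]"

end

theory Submission
  imports Defs
begin

text \<open>With \<open>N (a + bi + cj + dk) = a\<^sup>2 + b\<^sup>2 + c\<^sup>2 + d\<^sup>2\<close>, the octonion \<open>(a + b\<ell>)/2\<close> has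
  norm \<open>(N a + N b)/4\<close>, and every element of \<open>S_H4\<close> has \<open>N = 1\<close>. Since \<open>1\<close> and \<open>\<phi>\<close> are
  linearly independent over \<open>\<rat>\<close> and \<open>\<int>[\<phi>] = \<int> + \<int>\<phi>\<close>, the number \<open>1/2\<close> is not in \<open>\<int>[\<phi>]\<close>.
  The same independence encodes coordinates \<open>(m + n\<phi>)/2\<close> faithfully by integer pairs \<open>(m, n)\<close>,
  so that the 120 elements of \<open>S_H4\<close> can be counted by computation.\<close>

section \<open>Linear independence of 1 and the golden ratio\<close>

lemma real_of_qsqrt5_of_int: "real_of_qsqrt5 (of_int m) = of_int m"
  by (cases m rule: int_cases2)
    (simp_all add: real_of_qsqrt5_of_nat uminus_qsqrt5.rep_eq)

text \<open>Doubling turns the relation into \<open>(2 * m + n) + n * sqrt 5 = 0\<close>; a nonzero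
  \<open>n\<close> would make \<open>sqrt 5\<close> rational.\<close>

lemma Z_phi_independent:
  assumes "of_int m + of_int n * \<phi> = 0"
  shows "m = 0 \<and> n = 0"
proof -
  have "of_int (2 * m + n) + of_int n * sqrt5 = 0"
    using assms by (simp add: phi_def field_simps)
  then have "real_of_qsqrt5 (of_int (2 * m + n) + of_int n * sqrt5) = real_of_qsqrt5 0"
    by simp
  then have e: "real_of_int (2 * m + n) + of_int n * sqrt 5 = 0"
    by (simp only: plus_qsqrt5.rep_eq times_qsqrt5.rep_eq real_of_qsqrt5_of_int
        sqrt5.rep_eq zero_qsqrt5.rep_eq)
  have "n = 0"
  proof (rule ccontr)
    assume "n \<noteq> 0"
    with e have "sqrt 5 = of_rat (of_int (- (2 * m + n)) / of_int n)"
      by (simp only: of_rat_divide of_rat_of_int_eq) (simp add: field_simps)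
    then show False using sqrt5_irrat by blast
  qed
  with e show ?thesis by simp
qed

text \<open>Horner's scheme on the coefficients: each multiplication by \<open>\<phi>\<close> is
  reduced back to a linear expression by \<open>phi_square\<close>.\<close>

lemma Z_phi_subset: "\<int>[\<phi>] \<subseteq> {of_int m + of_int n * \<phi> | m n. True}"
proof -
  have "\<exists>m n. poly (map_poly of_int p) \<phi> = of_int m + of_int n * \<phi>" for p :: "int poly"
  proof (induction p)
    case 0
    then show ?case by (intro exI[of _ 0]) simp
  next
    case (pCons c p)
    then obtain m n where "poly (map_poly of_int p) \<phi> = of_int m + of_int n * \<phi>" by blast
    then have "poly (map_poly of_int (pCons c p)) \<phi> = of_int c + \<phi> * (of_int m + of_int n * \<phi>)"
      by (simp add: map_poly_pCons)
    also have "\<dots> = of_int c + of_int m * \<phi> + of_int n * (\<phi> * \<phi>)"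
      by (simp add: algebra_simps)
    also have "\<dots> = of_int (c + n) + of_int (m + n) * \<phi>"
      by (simp add: phi_square algebra_simps)
    finally show ?case by blast
  qed
  then show ?thesis by (auto simp: Z_phi_def)
qed

lemma half_notin_Z_phi: "1/2 \<notin> \<int>[\<phi>]"
proof
  assume "1/2 \<in> \<int>[\<phi>]"
  then obtain m n where "1/2 = of_int m + of_int n * \<phi>" using Z_phi_subset by blast
  \<comment> \<open>Doubling clears the denominator, and independence would force the odd integer
    \<open>2 * m - 1\<close> to vanish.\<close>
  then have "of_int (2 * m - 1) + of_int (2 * n) * \<phi> = 0" by (simp add: field_simps)
  then have "2 * m - 1 = 0" using Z_phi_independent by blast
  then show False by presburger
qed

section \<open>Norms\<close>

lemma inverse_phi: "inverse \<phi> = \<phi> - 1"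
proof (rule inverse_unique)
  show "\<phi> * (\<phi> - 1) = 1" by (simp add: right_diff_distrib phi_square)
qed

text \<open>Summing over the coordinate list makes invariance under coordinate permutations a fact
  about multisets.\<close>

definition qnorm :: "'a::comm_ring_1 quat \<Rightarrow> 'a"
  where "qnorm x = sum_list (map (\<lambda>c. c * c) (coords x))"

text \<open>In \<open>x * oconj x\<close> the second component is a multiple of
  \<open>- b * a + b * a\<close>, hence zero.\<close>

lemma octo_norm_oscale_Octo:
  "octo_norm (oscale r (Octo a b)) = octo_of (r * r * (qnorm a + qnorm b))"
  by (simp add: octo_norm_def oscale_def oconj_def qscale_def qconj_def octo_of_def qnorm_def
      coords_def times_octo_def one_octo_def one_quat_def zero_quat_def times_quat_def
      plus_quat_def minus_quat_def uminus_quat_def algebra_simps)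

lemma sum_list_map_permute_list:
  fixes f :: "'a \<Rightarrow> 'b::comm_monoid_add"
  assumes "\<pi> permutes {..<n}" "length xs = n"
  shows "sum_list (map f (permute_list \<pi> xs)) = sum_list (map f xs)"
  using assms by (metis mset_map mset_permute_list sum_mset_sum_list)

lemma qnorm_S_H4:
  assumes "x \<in> S_H4"
  shows "qnorm x = 1"
proof -
  have sq: "s * s = 1" if "s \<in> {1, - 1}" for s :: qsqrt5 using that by auto
  consider
      \<pi> s where "coords x = permute_list \<pi> [s, 0, 0, 0]" "\<pi> permutes {..<4}" "s \<in> {1, - 1}"
    | s0 s1 s2 s3 where "coords x = map (\<lambda>s. 1/2 * s) [s0, s1, s2, s3]"
        "{s0, s1, s2, s3} \<subseteq> {1, - 1}"
    | \<pi> s1 s2 s3 where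
        "coords x = permute_list \<pi> (map (\<lambda>c. 1/2 * c) [0, s1 * 1, s2 * \<phi>, s3 * inverse \<phi>])"
        "\<pi> permutes {..<4}" "{s1, s2, s3} \<subseteq> {1, - 1}"
    using assms unfolding S_H4_def by (elim CollectE UnE exE conjE)
  then show ?thesis
  proof cases
    case 1
    then show ?thesis by (simp add: qnorm_def sum_list_map_permute_list[OF 1(2)] sq)
  next
    case 2
    then show ?thesis by (simp add: qnorm_def sq)
  next
    case 3
    have "qnorm x = (s1 * s1 + s2 * s2 * (\<phi> * \<phi>) + s3 * s3 * ((\<phi> - 1) * (\<phi> - 1))) / 4"
      unfolding qnorm_def 3(1) inverse_phi
      by (simp add: sum_list_map_permute_list[OF 3(2)] field_simps)
    also have "\<dots> = (1 + \<phi> * \<phi> + (\<phi> - 1) * (\<phi> - 1)) / 4" using 3 by (simp add: sq)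
    \<comment> \<open>By \<open>phi_square\<close> the squares are \<open>1\<close>,
      \<open>\<phi> + 1\<close> and \<open>2 - \<phi>\<close>, with sum 4.\<close>
    also have "\<dots> = 1" by (simp add: algebra_simps phi_square)
    finally show ?thesis .
  qed
qed

section \<open>Permutations of four coordinates\<close>

text \<open>Every permutation of \<open>{0, 1, 2, 3}\<close> is uniquely \<open>(0 b) \<circ> (1 c) \<circ> (2 d)\<close> with \<open>b \<ge> 0\<close>,
  \<open>c \<ge> 1\<close>, \<open>d \<ge> 2\<close>; each proper transposition flips the sign.\<close>

lemma permutations_lessThan_4:
  "{\<pi>. \<pi> permutes {..<4::nat}} =
    (\<lambda>(b, c, d). transpose 0 b \<circ> (transpose 1 c \<circ> transpose 2 d))
      ` ({0,1,2,3} \<times> {1,2,3} \<times> {2,3})"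
proof -
  have step: "{p. p permutes insert a S} =
      (\<lambda>(b, p). transpose a b \<circ> p) ` (insert a S \<times> {p. p permutes S})"
    for a :: nat and S
    unfolding permutes_insert Sigma_def by auto
  \<comment> \<open>Flattens the three uses of \<open>step\<close> into one image over triples;
    \<open>e\<close> is the identity, the only permutation of \<open>{3}\<close>.\<close>
  have nested_image: "(\<lambda>(b, p). f b p) ` (A \<times> (\<lambda>(c, q). g c q) ` (B \<times> (\<lambda>(d, r). h d r) ` (C \<times> {e}))) =
      (\<lambda>(b, c, d). f b (g c (h d e))) ` (A \<times> B \<times> C)"
    for f :: "nat \<Rightarrow> (nat \<Rightarrow> nat) \<Rightarrow> nat \<Rightarrow> nat" and g h :: "nat \<Rightarrow> (nat \<Rightarrow> nat) \<Rightarrow> nat \<Rightarrow> nat" and A B C e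
    by (auto simp: image_def) blast
  have "{..<4} = {0, 1, 2, 3::nat}" by auto
  moreover have "{p. p permutes {3::nat}} = {id}" by auto
  ultimately show ?thesis by (simp only: step nested_image comp_id)
qed

lemma evenperm_transposes:
  "evenperm (transpose a b \<circ> (transpose c d \<circ> transpose e f))
    \<longleftrightarrow> ((a = b) = ((c = d) = (e = f)))"
  by (simp add: evenperm_comp permutation_compose permutation_swap_id evenperm_swap)

text \<open>Polymorphic, like \<open>even_arrangements\<close>, so that one table serves both field
  values and integer codes and commutes with \<open>map\<close>.\<close>

definition single_arrangements :: "'a \<Rightarrow> 'a \<Rightarrow> 'a list list"
  where "single_arrangements s z = [[s, z, z, z], [z, s, z, z], [z, z, s, z], [z, z, z, s]]"

definition even_arrangements :: "'a \<Rightarrow> 'a \<Rightarrow> 'a \<Rightarrow> 'a \<Rightarrow> 'a list list"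
  where "even_arrangements a b c d =
    [[a, b, c, d], [a, c, d, b], [a, d, b, c], [b, a, d, c], [b, c, a, d], [b, d, c, a],
     [c, b, d, a], [c, a, b, d], [c, d, a, b], [d, b, a, c], [d, c, b, a], [d, a, c, b]]"

lemma permute_list_4:
  "permute_list \<pi> [x0, x1, x2, x3] = map (\<lambda>i. [x0, x1, x2, x3] ! \<pi> i) [0, 1, 2, 3]"
  by (simp add: permute_list_def upt_rec numeral_2_eq_2 numeral_3_eq_3)

lemma permute_list_single:
  "{permute_list \<pi> [s, z, z, z] | \<pi>. \<pi> permutes {..<4}} = set (single_arrangements s z)"
proof -
  have "{permute_list \<pi> [s, z, z, z] | \<pi>. \<pi> permutes {..<4}} =
      (\<lambda>\<pi>. permute_list \<pi> [s, z, z, z]) ` {\<pi>. \<pi> permutes {..<4}}"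
    by blast
  also have "\<dots> = set (single_arrangements s z)"
    unfolding permutations_lessThan_4
    by (auto simp: single_arrangements_def permute_list_4 transpose_def)
  finally show ?thesis .
qed

lemma permute_list_even:
  "{permute_list \<pi> [x0, x1, x2, x3] | \<pi>. \<pi> permutes {..<4} \<and> evenperm \<pi>} =
   set (even_arrangements x0 x1 x2 x3)"
proof -
  let ?g = "\<lambda>b c d. transpose 0 b \<circ> (transpose 1 c \<circ> transpose (2::nat) d)"
  let ?f = "\<lambda>\<pi>. permute_list \<pi> [x0, x1, x2, x3]"
  note nat_neqs = zero_neq_one one_neq_zero zero_neq_numeral numeral_neq_zero
    one_eq_numeral_iff numeral_eq_one_iff numeral_eq_iff num.simps
  have filter_image: "f ` {x \<in> (\<lambda>(b, c, d). g b c d) ` (A \<times> B \<times> C). P x} =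
      (\<Union>b\<in>A. \<Union>c\<in>B. \<Union>d\<in>C. if P (g b c d) then {f (g b c d)} else {})"
    for f :: "(nat \<Rightarrow> nat) \<Rightarrow> 'a list" and g :: "nat \<Rightarrow> nat \<Rightarrow> nat \<Rightarrow> nat \<Rightarrow> nat" and P A B C
    unfolding image_def by (auto split: if_splits)
  have "{?f \<pi> | \<pi>. \<pi> permutes {..<4} \<and> evenperm \<pi>} =
      ?f ` {\<pi> \<in> {\<pi>. \<pi> permutes {..<4}}. evenperm \<pi>}"
    by blast
  also have "\<dots> = (\<Union>b\<in>{0,1,2,3}. \<Union>c\<in>{1,2,3}. \<Union>d\<in>{2,3}.
      if (0 = b) = ((1 = c) = (2 = d)) then {?f (?g b c d)} else {})"
    unfolding permutations_lessThan_4 filter_image evenperm_transposes ..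
  \<comment> \<open>The 12 of the 24 triples for which an even number of
    \<open>b \<noteq> 0\<close>, \<open>c \<noteq> 1\<close>, \<open>d \<noteq> 2\<close>
    hold.\<close>
  also have "\<dots> = {?f (?g 0 1 2), ?f (?g 0 2 3), ?f (?g 0 3 3), ?f (?g 1 1 3), ?f (?g 1 2 2),
      ?f (?g 1 3 2), ?f (?g 2 1 3), ?f (?g 2 2 2), ?f (?g 2 3 2), ?f (?g 3 1 3), ?f (?g 3 2 2),
      ?f (?g 3 3 2)}"
    by (simp only: UN_insert UN_empty Un_empty_right Un_empty_left Un_insert_left nat_neqs
        simp_thms if_True if_False)
  also have "\<dots> = set (even_arrangements x0 x1 x2 x3)"
    by (simp only: permute_list_4 o_apply transpose_def list.map nat_neqs simp_thms if_True if_False)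
      (simp add: even_arrangements_def)
  finally show ?thesis .
qed

section \<open>Counting by integer codes\<close>

definition half_Z_phi :: "int \<times> int \<Rightarrow> qsqrt5"
  where "half_Z_phi = (\<lambda>(m, n). (of_int m + of_int n * \<phi>) / 2)"

lemma inj_half_Z_phi: "inj half_Z_phi"
proof (rule injI, clarify)
  fix m n m' n'
  assume "half_Z_phi (m, n) = half_Z_phi (m', n')"
  then have "of_int m + of_int n * \<phi> = of_int m' + of_int n' * \<phi>"
    by (simp only: half_Z_phi_def case_prod_conv divide_cancel_right) simp
  then have "of_int (m - m') + of_int (n - n') * \<phi> = 0"
    by (simp add: algebra_simps)
  then show "m = m' \<and> n = n'" using Z_phi_independent by fastforce
qed

text \<open>The families have 8, 16 and 96 entries. With the common denominator 2, a unit
  \<open>s\<close> becomes \<open>(2 * s, 0)\<close>, and \<open>(- s3, s3)\<close> stands for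
  \<open>s3 * inverse \<phi> / 2\<close> because \<open>inverse \<phi> = \<phi> - 1\<close>.\<close>

definition H4_codes :: "(int \<times> int) list list" where
  "H4_codes =
    concat (map (\<lambda>s. single_arrangements (2 * s, 0) (0, 0)) [1, - 1]) @
    concat (map (\<lambda>s0. concat (map (\<lambda>s1. concat (map (\<lambda>s2. map (\<lambda>s3.
      [(s0, 0), (s1, 0), (s2, 0), (s3, 0)]) [1, - 1]) [1, - 1])) [1, - 1])) [1, - 1]) @
    concat (map (\<lambda>s1. concat (map (\<lambda>s2. concat (map (\<lambda>s3.
      even_arrangements (0, 0) (s1, 0) (0, s2) (- s3, s3)) [1, - 1])) [1, - 1])) [1, - 1])"

text \<open>The list has 120 entries, so the evaluation amounts to checking that they are
  distinct.\<close>

lemma card_H4_codes: "card (set H4_codes) = 120"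
  by code_simp

lemma image_map_single_arrangements:
  "map f ` set (single_arrangements s z) = set (single_arrangements (f s) (f z))"
  by (simp add: single_arrangements_def)

lemma image_map_even_arrangements:
  "map f ` set (even_arrangements a b c d) = set (even_arrangements (f a) (f b) (f c) (f d))"
  by (simp add: even_arrangements_def)

lemma half_Z_phi_simps:
  "half_Z_phi (0, 0) = 0"
  "half_Z_phi (2 * s, 0) = of_int s"
  "half_Z_phi (s, 0) = of_int s / 2"
  "half_Z_phi (0, s) = of_int s * \<phi> / 2"
  "half_Z_phi (- s, s) = of_int s * (\<phi> - 1) / 2"
  by (simp_all add: half_Z_phi_def right_diff_distrib)

lemma S_H4_eq_vimage: "S_H4 = coords -` (map half_Z_phi ` set H4_codes)"
proof -
  \<comment> \<open>The signs are needed both as integers in the codes (\<open>T\<close>) and as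
    field elements in \<open>S_H4\<close> (\<open>S\<close>); since \<open>S\<close> is the image of
    \<open>T\<close>, unions over \<open>T\<close> become unions over \<open>S\<close>.\<close>
  define T where "T = set [1, - 1 :: int]"
  define S where "S = (of_int ` T :: qsqrt5 set)"
  have S: "{1, - 1} = S" by (simp add: S_def T_def)
  have axes: "{permute_list \<pi> [s, 0, 0, 0] | \<pi> s. \<pi> permutes {..<4} \<and> s \<in> S} =
      (\<Union>s\<in>S. set (single_arrangements s 0))"
    unfolding permute_list_single[symmetric] by blast
  have halves: "{map (\<lambda>s. 1/2 * s) [s0, s1, s2, s3] | s0 s1 s2 s3. {s0, s1, s2, s3} \<subseteq> S} =
      (\<Union>s0\<in>S. \<Union>s1\<in>S. \<Union>s2\<in>S. \<Union>s3\<in>S. {[s0/2, s1/2, s2/2, s3/2]})"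
    by auto
  have golden: "{permute_list \<pi> (map (\<lambda>c. 1/2 * c) [0, s1 * 1, s2 * \<phi>, s3 * inverse \<phi>]) | \<pi> s1 s2 s3.
          \<pi> permutes {..<4} \<and> evenperm \<pi> \<and> {s1, s2, s3} \<subseteq> S} =
      (\<Union>s1\<in>S. \<Union>s2\<in>S. \<Union>s3\<in>S.
        set (even_arrangements 0 (s1/2) (s2 * \<phi> / 2) (s3 * (\<phi> - 1) / 2)))"
    unfolding permute_list_even[symmetric] inverse_phi by auto
  have "set H4_codes =
      (\<Union>s\<in>T. set (single_arrangements (2 * s, 0) (0, 0))) \<union>
      (\<Union>s0\<in>T. \<Union>s1\<in>T. \<Union>s2\<in>T. \<Union>s3\<in>T. {[(s0, 0), (s1, 0), (s2, 0), (s3, 0)]}) \<union>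
      (\<Union>s1\<in>T. \<Union>s2\<in>T. \<Union>s3\<in>T. set (even_arrangements (0, 0) (s1, 0) (0, s2) (- s3, s3)))"
    unfolding H4_codes_def T_def set_append set_concat set_map image_image UNION_singleton_eq_range
    by (simp only: Un_assoc)
  then have "map half_Z_phi ` set H4_codes =
      (\<Union>s\<in>S. set (single_arrangements s 0)) \<union>
      (\<Union>s0\<in>S. \<Union>s1\<in>S. \<Union>s2\<in>S. \<Union>s3\<in>S. {[s0/2, s1/2, s2/2, s3/2]}) \<union>
      (\<Union>s1\<in>S. \<Union>s2\<in>S. \<Union>s3\<in>S.
        set (even_arrangements 0 (s1/2) (s2 * \<phi> / 2) (s3 * (\<phi> - 1) / 2)))"
    by (simp add: image_Un image_UN image_map_single_arrangements image_map_even_arrangements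
        half_Z_phi_simps S_def)
  then show ?thesis unfolding S_H4_def S axes halves golden by auto
qed

lemma card_S_H4: "card S_H4 = 120"
proof -
  have "inj coords" by (rule injI) (simp add: coords_def quat_eqI)
  \<comment> \<open>No code is lost in the preimage: each decoded list has length 4, so it is the
    coordinate list of a quaternion.\<close>
  moreover have "map half_Z_phi ` set H4_codes \<subseteq> range coords"
  proof clarify
    fix c assume "c \<in> set H4_codes"
    then have "length c = 4"
      by (auto simp: H4_codes_def single_arrangements_def even_arrangements_def)
    then obtain c0 c1 c2 c3 where "c = [c0, c1, c2, c3]"
      by (auto simp: numeral_eq_Suc length_Suc_conv)
    then have "map half_Z_phi c =
        coords (Quat (half_Z_phi c0) (half_Z_phi c1) (half_Z_phi c2) (half_Z_phi c3))"
      by (simp add: coords_def)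
    then show "map half_Z_phi c \<in> range coords" by blast
  qed
  ultimately have "card S_H4 = card (map half_Z_phi ` set H4_codes)"
    unfolding S_H4_eq_vimage by (rule card_vimage_inj)
  also have "\<dots> = card (set H4_codes)"
    by (intro card_image inj_on_subset[OF inj_mapI[OF inj_half_Z_phi]] subset_UNIV)
  finally show ?thesis by (simp add: card_H4_codes)
qed

theorem proposition6p14:
  "card (S_H4 \<times> S_H4) = 14400 \<and>
   (\<forall>(a, b) \<in> S_H4 \<times> S_H4.
      let x = oscale (1/2) (Octo a b) in
        octo_norm x = octo_of (1/2) \<and>
        octo_norm x \<notin> octo_of ` \<int>[\<phi>] \<and>
        \<not> integral_norm x)"
proof -
  have "octo_norm (oscale (1/2) (Octo a b)) = octo_of (1/2)" if "a \<in> S_H4" "b \<in> S_H4" for a b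
    using that by (simp add: octo_norm_oscale_Octo qnorm_S_H4)
  \<comment> \<open>Injectivity of \<open>octo_of\<close> brings the question back to the
    field.\<close>
  moreover have "octo_of (1/2) \<notin> octo_of ` \<int>[\<phi>]"
    using half_notin_Z_phi by (simp add: inj_image_mem_iff[OF inj_octo_of])
  ultimately show ?thesis
    by (auto simp: Let_def integral_norm_def card_cartesian_product card_S_H4)
qed

end
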